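(* Let $s\ge 3$ be an integer. As $n\to\infty$ (with $s$ fixed): if $s$ is odd, then $$\mathrm{exco}_2(n,S_s^3)=s(s-1)n^2(1+o(1));$$ if $s$ is even, then $$\mathrm{exco}_2(n,S_s^3)=\left(s^2-\frac32 s\right)n^2(1+o(1)).$$
   Context: $S_s^3$ is the $3$-uniform star with $s$ edges: there is a vertex $v$ such that any two distinct edges intersect in exactly $\{v\}$ (so $S_s^3$ has $2s+1$ vertices). A $3$-uniform hypergraph is $H$-free if it contains no (not necessarily induced) copy of $H$ as a subhypergraph. For a $3$-uniform hypergraph $G$ and distinct vertices $x,y$, $d_G(x,y)$ is the number of edges containing both $x$ and $y$, and $\mathrm{co}_2(G)=\sum_{\{x,y\}\in\binom{V(G)}{2}}d_G(x,y)^2$. $\mathrm{exco}_2(n,H)$ is the maximum of $\mathrm{co}_2(G)$ over all $H$-free $3$-uniform hypergraphs $G$ on $n$ vertices. *)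

theory Defs
  imports Complex_Main "HOL-Library.Landau_Symbols"
begin

record 'a hypergraph =
  verts :: "'a set"
  edges :: "'a set set"

definition uniform3 :: "'a hypergraph \<Rightarrow> bool" where
  "uniform3 G \<longleftrightarrow> finite (verts G) \<and> (\<forall>e\<in>edges G. e \<subseteq> verts G \<and> card e = 3)"

definition contains_copy :: "'a hypergraph \<Rightarrow> 'b hypergraph \<Rightarrow> bool" where
  "contains_copy G H \<longleftrightarrow>
     (\<exists>f. inj_on f (verts H) \<and> f ` verts H \<subseteq> verts G \<and> (\<forall>e\<in>edges H. f ` e \<in> edges G))"

(* d_G(x,y) is codeg G {x, y}; pairs are sets so that co2 sums over unordered pairs. *)
definition codeg :: "'a hypergraph \<Rightarrow> 'a set \<Rightarrow> nat" where
  "codeg G p = card {e \<in> edges G. p \<subseteq> e}"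

definition co2 :: "'a hypergraph \<Rightarrow> nat" where
  "co2 G = (\<Sum>p | p \<subseteq> verts G \<and> card p = 2. (codeg G p)\<^sup>2)"

(* co2 and the containment of H are invariant under isomorphism, so it suffices to let G
   range over the hypergraphs with vertex set {0, ..., n-1}. *)
definition exco2 :: "nat \<Rightarrow> 'b hypergraph \<Rightarrow> nat" where
  "exco2 n H = Max {co2 G | G :: nat hypergraph.
     uniform3 G \<and> verts G = {..<n} \<and> \<not> contains_copy G H}"

(* The star with centre 0; its i-th edge is {0, 2i+1, 2i+2}. *)
definition star3 :: "nat \<Rightarrow> nat hypergraph" where
  "star3 s = \<lparr>verts = {..2 * s}, edges = (\<lambda>i. {0, 2 * i + 1, 2 * i + 2}) ` {..<s}\<rparr>"

lemma uniform3_star3: "uniform3 (star3 s)"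
  by (auto simp: uniform3_def star3_def)

lemma card_verts_star3: "card (verts (star3 s)) = 2 * s + 1"
  by (simp add: star3_def)

lemma card_edges_star3: "card (edges (star3 s)) = s"
proof -
  have "inj_on (\<lambda>i::nat. {0, 2 * i + 1, 2 * i + 2}) {..<s}"
  proof (rule inj_onI)
    fix i j :: nat
    assume "{0, 2 * i + 1, 2 * i + 2} = {0, 2 * j + 1, 2 * j + 2}"
    then have "2 * i + 1 \<in> {0, 2 * j + 1, 2 * j + 2}" by blast
    then show "i = j" by auto
  qed
  then show ?thesis by (simp add: star3_def card_image)
qed

lemma star3_inter:
  assumes "e \<in> edges (star3 s)" "e' \<in> edges (star3 s)" "e \<noteq> e'"
  shows "e \<inter> e' = {0}"
proof -
  obtain i j where "e = {0, 2 * i + 1, 2 * i + 2}" "e' = {0, 2 * j + 1, 2 * j + 2}"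
    using assms(1,2) by (auto simp: star3_def)
  moreover have "i \<noteq> j" using calculation assms(3) by blast
  ultimately show ?thesis by (auto; presburger)
qed

lemma finite_exco2_set:
  "finite {co2 G | G :: nat hypergraph.
     uniform3 G \<and> verts G = {..<n} \<and> \<not> contains_copy G H}"
proof (rule finite_subset)
  show "{co2 G | G :: nat hypergraph.
      uniform3 G \<and> verts G = {..<n} \<and> \<not> contains_copy G H}
    \<subseteq> (\<lambda>E. co2 \<lparr>verts = {..<n}, edges = E\<rparr>) ` Pow (Pow {..<n})"
  proof
    fix c
    assume "c \<in> {co2 G | G :: nat hypergraph.
      uniform3 G \<and> verts G = {..<n} \<and> \<not> contains_copy G H}"
    then obtain G :: "nat hypergraph"
      where "c = co2 G" "uniform3 G" "verts G = {..<n}" by blast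
    then show "c \<in> (\<lambda>E. co2 \<lparr>verts = {..<n}, edges = E\<rparr>) ` Pow (Pow {..<n})"
      by (intro image_eqI[of _ _ "edges G"]) (auto simp: uniform3_def co2_def codeg_def)
  qed
qed simp

lemma exco2_set_nonempty:
  assumes "edges H \<noteq> {}"
  shows "{co2 G | G :: nat hypergraph.
     uniform3 G \<and> verts G = {..<n} \<and> \<not> contains_copy G H} \<noteq> {}"
proof -
  let ?G = "\<lparr>verts = {..<n}, edges = {}\<rparr>"
  have "uniform3 ?G \<and> verts ?G = {..<n} \<and> \<not> contains_copy ?G H"
    using assms by (auto simp: uniform3_def contains_copy_def)
  then show ?thesis by blast
qed

end

theory Submission
  imports Defs
begin

text \<open>
  The quantity \<open>co2 G\<close> is dominated by few pairs of very large codegree. Call a pair heavy if its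
  codegree is at least \<open>2 * s\<close>. A copy of the star centred at \<open>z\<close> is a matching of size \<open>s\<close> in the
  link graph of \<open>z\<close> (\<open>copy_star3_iff\<close>). In a star-free hypergraph, therefore, every link has
  matching number below \<open>s\<close>. Moreover every vertex lies in fewer than \<open>s\<close> heavy pairs, since from
  \<open>s\<close> of them one could build a star greedily (\<open>degree_heavy\<close>).

  So the heavy pairs inside the link of any vertex form a graph with maximum degree and matching
  number at most \<open>s - 1\<close>. By a theorem of Chvatal and Hanson (\<open>chvatal_hanson\<close>) such a graph has at
  most \<open>F\<close> edges, where \<open>F = s * (s - 1)\<close> for odd \<open>s\<close> and \<open>F = (s - 1)\<^sup>2 + (s - 2) div 2\<close>, which
  equals \<open>s\<^sup>2 - 3 * s / 2\<close>, for even \<open>s\<close>. Counting by the third vertex, the codegrees of heavy pairs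
  add up to at most \<open>F * n\<close>; as each codegree is at most \<open>n\<close>, their squares add up to at most
  \<open>F * n\<^sup>2\<close>. The light pairs contribute only a linear term: their codegrees are bounded, and the
  hypergraph has only linearly many edges, again by \<open>chvatal_hanson\<close> applied to links.

  For the lower bound, take an extremal graph \<open>H\<close> of the Chvatal--Hanson theorem on a fixed vertex
  set and all triples that consist of an edge of \<open>H\<close> and one vertex outside that set. This hypergraph
  contains no star, and each of the \<open>F\<close> edges of \<open>H\<close> has codegree \<open>n - O(1)\<close>.

  The Chvatal--Hanson theorem is proved by the method of Gallai's lemma. Vertices contained in all
  maximum matchings are removed one at a time, at a cost of at most \<open>k\<close> edges each. When none is
  left, the vertices split into classes such that all edges run inside classes and every maximum
  matching misses at most one vertex of each class. A class with \<open>m\<close> matching edges thus has at most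
  \<open>2 * m + 1\<close> vertices, and its edges can be counted directly.
\<close>

section \<open>Graphs with bounded degree and matching number\<close>

definition matching :: "'a set set \<Rightarrow> 'a set set \<Rightarrow> bool" where
  "matching E M \<longleftrightarrow> M \<subseteq> E \<and> pairwise disjnt M"

definition max_matching :: "'a set set \<Rightarrow> 'a set set \<Rightarrow> bool" where
  "max_matching E M \<longleftrightarrow> matching E M \<and> (\<forall>N. matching E N \<longrightarrow> card N \<le> card M)"

definition finite_graph :: "'a set set \<Rightarrow> bool" where
  "finite_graph E \<longleftrightarrow> finite E \<and> (\<forall>e\<in>E. card e = 2)"

definition degree :: "'a set set \<Rightarrow> 'a \<Rightarrow> nat" where
  "degree E v = card {e \<in> E. v \<in> e}"

text \<open>
  The Chvatal--Hanson function: the largest number of edges of a graph with maximum degree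
  at most \<open>k\<close> and matching number at most \<open>m\<close>. The term \<open>k * m\<close> is what \<open>m\<close> vertices of degree
  \<open>k\<close> can cover; the second term is the gain from components with \<open>2 * i + 1\<close> vertices and
  \<open>i = (k + 1) div 2\<close> matching edges, each of which carries \<open>k div 2\<close> additional edges.
\<close>
definition chvatal_hanson_bound :: "nat \<Rightarrow> nat \<Rightarrow> nat" where
  "chvatal_hanson_bound k m = k * m + (k div 2) * (m div ((k + 1) div 2))"

lemma finite_graph_subset: "finite_graph E \<Longrightarrow> F \<subseteq> E \<Longrightarrow> finite_graph F"
  by (auto simp: finite_graph_def intro: finite_subset)

lemma finite_edge: "finite_graph E \<Longrightarrow> e \<in> E \<Longrightarrow> finite e"
  by (metis card.infinite finite_graph_def zero_neq_numeral)

lemma finite_vertices: "finite_graph E \<Longrightarrow> finite (\<Union>E)"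
  using finite_edge by (auto simp: finite_graph_def)

lemma degree_mono: "finite_graph E \<Longrightarrow> F \<subseteq> E \<Longrightarrow> degree F v \<le> degree E v"
  unfolding degree_def finite_graph_def by (intro card_mono) auto

lemma matching_mono: "matching F M \<Longrightarrow> F \<subseteq> E \<Longrightarrow> matching E M"
  by (auto simp: matching_def)

lemma card_Union_matching:
  assumes "finite_graph E" "matching E M"
  shows "card (\<Union>M) = 2 * card M"
proof -
  have "card (\<Union>M) = sum card M"
    using assms finite_edge by (intro card_Union_disjoint) (auto simp: matching_def)
  also have "\<dots> = (\<Sum>e\<in>M. 2)"
    using assms by (intro sum.cong) (auto simp: matching_def finite_graph_def)
  finally show ?thesis by simp
qed

lemma matching_unique:
  "matching E M \<Longrightarrow> d \<in> M \<Longrightarrow> e \<in> M \<Longrightarrow> v \<in> d \<Longrightarrow> v \<in> e \<Longrightarrow> d = e"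
  unfolding matching_def by (metis disjnt_iff pairwiseD)

lemma matching_insert:
  assumes "matching E M" "e \<in> E" "e \<inter> \<Union>M = {}"
  shows "matching E (insert e M)"
  using assms unfolding matching_def pairwise_insert disjnt_def by blast

lemma max_matching_exists:
  assumes "finite_graph E"
  obtains M where "max_matching E M"
proof -
  have "matching E {}" by (simp add: matching_def)
  moreover have "card N \<le> card E" if "matching E N" for N
    using that assms by (auto simp: matching_def finite_graph_def intro: card_mono)
  ultimately obtain M where "matching E M" "\<forall>N. matching E N \<longrightarrow> card N \<le> card M"
    using ex_has_greatest_nat[of "matching E" "{}" card "Suc (card E)"] by (auto simp: less_Suc_eq_le)
  then show ?thesis using that by (auto simp: max_matching_def)
qed

lemma sum_degree:
  assumes "finite_graph E" "finite A" "\<Union>E \<subseteq> A"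
  shows "(\<Sum>v\<in>A. degree E v) = 2 * card E"
proof -
  have "\<forall>e\<in>E. card {v \<in> A. v \<in> e} = 2"
  proof
    fix e assume "e \<in> E"
    then have "{v \<in> A. v \<in> e} = e" using assms(3) by blast
    then show "card {v \<in> A. v \<in> e} = 2" using assms(1) \<open>e \<in> E\<close> by (simp add: finite_graph_def)
  qed
  then show ?thesis
    unfolding degree_def using assms by (subst sum_multicount) (auto simp: finite_graph_def)
qed

lemma edge_meets_max_matching:
  assumes "finite_graph E" "max_matching E M" "e \<in> E"
  shows "e \<inter> \<Union>M \<noteq> {}"
proof
  assume *: "e \<inter> \<Union>M = {}"
  have "finite M" using assms by (auto simp: max_matching_def matching_def finite_graph_def intro: finite_subset)
  have "e \<noteq> {}" using assms by (auto simp: finite_graph_def)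
  then have "e \<notin> M" using * by auto
  then have "card (insert e M) = Suc (card M)" using \<open>finite M\<close> by simp
  moreover have "matching E (insert e M)"
    using assms * by (intro matching_insert) (auto simp: max_matching_def)
  ultimately show False using assms(2) by (auto simp: max_matching_def)
qed

text \<open>
  The exchange argument behind Gallai's lemma. If every vertex can be missed by a maximum matching,
  this says that ``no maximum matching misses both'' is a transitive relation. Among the maximum
  matchings that miss \<open>t\<close>, take \<open>N\<close> with the largest overlap with \<open>M\<close>. If \<open>N\<close> covered both \<open>u\<close> and
  \<open>v\<close>, then counting gives a vertex \<open>x \<noteq> t\<close> covered by \<open>M\<close> and not by \<open>N\<close>; moving the \<open>N\<close>-edge at the
  \<open>M\<close>-partner of \<open>x\<close> onto the \<open>M\<close>-edge at \<open>x\<close> would increase the overlap.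
\<close>
lemma gallai:
  assumes E: "finite_graph E"
    and M: "max_matching E M" "u \<notin> \<Union>M" "v \<notin> \<Union>M" "u \<noteq> v"
    and t: "max_matching E N0" "t \<notin> \<Union>N0"
  shows "\<exists>N. max_matching E N \<and> t \<notin> \<Union>N \<and> (u \<notin> \<Union>N \<or> v \<notin> \<Union>N)"
proof (rule ccontr)
  assume contra: "\<not> ?thesis"
  let ?P = "\<lambda>N. max_matching E N \<and> t \<notin> \<Union>N"
  have finE: "finite E" using E by (simp add: finite_graph_def)
  have fin: "finite N" if "max_matching E N" for N
    using that finE by (auto simp: max_matching_def matching_def intro: finite_subset)
  have "card (M \<inter> N) < Suc (card M)" for N
    using fin[OF M(1)] by (simp add: less_Suc_eq_le card_mono)
  then obtain N where N: "?P N" and best: "\<And>N'. ?P N' \<Longrightarrow> card (M \<inter> N') \<le> card (M \<inter> N)"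
    using ex_has_greatest_nat[of ?P N0 "\<lambda>N. card (M \<inter> N)" "Suc (card M)"] t by blast
  have matM: "matching E M" and matN: "matching E N"
    using M N by (auto simp: max_matching_def)
  have cardMN: "card M = card N"
    using M(1) N by (auto simp: max_matching_def intro: antisym)
  have finU: "finite (\<Union>M)" "finite (\<Union>N)"
    using finite_vertices[OF E] matM matN by (auto simp: matching_def intro: finite_subset[OF Union_mono])
  have uv: "u \<in> \<Union>N" "v \<in> \<Union>N" using contra N by auto
  have "card (\<Union>M) = card (\<Union>N)"
    using card_Union_matching[OF E matM] card_Union_matching[OF E matN] cardMN by simp
  then have "card (\<Union>M - \<Union>N) = card (\<Union>N - \<Union>M)"
    using finU by (metis card_Diff_subset_Int finite_Int inf_commute)
  moreover have "card {u, v} \<le> card (\<Union>N - \<Union>M)"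
    using uv M finU by (intro card_mono) auto
  ultimately have "2 \<le> card (\<Union>M - \<Union>N)" using M(4) by simp
  moreover have "\<Union>M - \<Union>N \<subseteq> {t}" if "\<not> (\<exists>x\<in>\<Union>M - \<Union>N. x \<noteq> t)" using that by blast
  ultimately obtain x where x: "x \<in> \<Union>M" "x \<notin> \<Union>N" "x \<noteq> t"
    using card_mono[of "{t}" "\<Union>M - \<Union>N"] by fastforce
  then obtain e where e: "e \<in> M" "x \<in> e" by blast
  have "e \<in> E" using e matM by (auto simp: matching_def)
  then have "card e = 2" using E by (simp add: finite_graph_def)
  then have "\<exists>y. e = {x, y} \<and> x \<noteq> y"
    using e(2) by (metis card_2_iff insertE insert_commute singletonD)
  then obtain y where y: "e = {x, y}" "x \<noteq> y" by blast
  then have "y \<in> \<Union>N" using edge_meets_max_matching[OF E _ \<open>e \<in> E\<close>, of N] N x by auto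
  then obtain d where d: "d \<in> N" "y \<in> d" by blast
  have "d \<notin> M"
  proof
    assume "d \<in> M"
    then have "d = e" using matching_unique[OF matM _ e(1) d(2)] y by simp
    then show False using d e x by blast
  qed
  have other: "e \<inter> \<Union>(N - {d}) = {}"
    using matching_unique[OF matN _ d(1) _ d(2)] y x by auto
  define N' where "N' = insert e (N - {d})"
  have "matching E N'"
    unfolding N'_def using matN \<open>e \<in> E\<close> other
    by (intro matching_insert) (auto simp: matching_def pairwise_def)
  moreover have "e \<notin> N" using e x by blast
  then have "card N' = card N"
    unfolding N'_def using fin N d card_Suc_Diff1[of N d] by simp
  moreover have "t \<noteq> y" using N d by blast
  then have "t \<notin> \<Union>N'" unfolding N'_def using N x y by blast
  ultimately have "?P N'" using N by (auto simp: max_matching_def)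
  then have "card (M \<inter> N') \<le> card (M \<inter> N)" by (rule best)
  moreover have "M \<inter> N' = insert e (M \<inter> N)"
    unfolding N'_def using e \<open>d \<notin> M\<close> by blast
  ultimately show False using \<open>e \<notin> N\<close> fin N by simp
qed

text \<open>
  The local estimate for one class of Gallai's decomposition, with \<open>m\<close> matching edges on at most
  \<open>2 * m + 1\<close> vertices. For large \<open>m\<close> the degrees limit the number of edges, and for small \<open>m\<close> the
  number of pairs does; the two regimes meet at \<open>m = (k + 1) div 2\<close>.
\<close>
lemma card_edges_small_vertex_set:
  assumes E: "finite_graph E" and A: "finite A" "\<Union>E \<subseteq> A" "card A \<le> 2 * m + 1"
    and deg: "\<And>v. degree E v \<le> k"
  shows "card E \<le> chvatal_hanson_bound k m"
proof (cases "(k + 1) div 2 \<le> m")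
  case True
  have "2 * card E \<le> (\<Sum>v\<in>A. k)"
    using sum_degree[OF E A(1,2)] deg by (metis sum_mono)
  also have "\<dots> \<le> (2 * m + 1) * k" using mult_right_mono[OF A(3), of k] by simp
  finally have "card E \<le> k * m + k div 2" by (simp add: algebra_simps)
  also have "k div 2 \<le> (k div 2) * (m div ((k + 1) div 2))"
  proof (cases "k = 0")
    case False
    then have "0 < (k + 1) div 2" by simp
    then have "1 \<le> m div ((k + 1) div 2)" using True by (simp add: Suc_le_eq div_greater_zero_iff)
    then show ?thesis by simp
  qed simp
  finally show ?thesis by (simp add: chvatal_hanson_bound_def)
next
  case False
  then have k: "2 * m + 1 \<le> k" by linarith
  have "E \<subseteq> {e. e \<subseteq> A \<and> card e = 2}" using A E by (auto simp: finite_graph_def)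
  then have "card E \<le> card A choose 2" using A(1) 
    by (subst n_subsets[OF A(1), symmetric]) (rule card_mono, simp_all)
  also have "\<dots> \<le> (2 * m + 1) choose 2" using A(3) by (rule binomial_right_mono)
  also have "\<dots> = (2 * m + 1) * m" by (simp add: choose_two)
  also have "\<dots> \<le> k * m" using k by (rule mult_right_mono) simp
  finally show ?thesis by (simp add: chvatal_hanson_bound_def)
qed

lemma sum_div_le: "(\<Sum>i\<in>I. f i div q) \<le> (\<Sum>i\<in>I. f i) div (q::nat)"
proof (induction I rule: infinite_finite_induct)
  case (insert i I)
  have "f i div q + (\<Sum>i\<in>I. f i) div q \<le> (f i + (\<Sum>i\<in>I. f i)) div q"
    by (metis div_add1_eq le_add1)
  then show ?case using insert by simp
qed auto

lemma chvatal_hanson_bound_sum: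
  "(\<Sum>i\<in>I. chvatal_hanson_bound k (f i)) \<le> chvatal_hanson_bound k (\<Sum>i\<in>I. f i)"
  by (simp add: chvatal_hanson_bound_def sum.distrib sum_div_le flip: sum_distrib_left)

lemma chvatal_hanson_bound_mono:
  "m \<le> m' \<Longrightarrow> chvatal_hanson_bound k m \<le> chvatal_hanson_bound k m'"
  by (simp add: chvatal_hanson_bound_def add_mono div_le_mono mult_le_mono)

lemma chvatal_hanson_bound_Suc:
  "chvatal_hanson_bound k m + k \<le> chvatal_hanson_bound k (Suc m)"
  by (simp add: chvatal_hanson_bound_def div_le_mono)

text \<open>
  If some vertex lies in every maximum matching, deleting it lowers the matching number and costs at
  most \<open>k\<close> edges, so induction applies. Otherwise \<open>gallai\<close> makes ``no maximum matching misses both''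
  an equivalence relation. Adjacent vertices are equivalent, because otherwise a maximum matching
  could be extended, so all edges run inside classes. A maximum matching misses at most one vertex
  of each class, so \<open>card_edges_small_vertex_set\<close> applies to the classes, and the bound is
  superadditive in the matching number.
\<close>
theorem chvatal_hanson:
  assumes "finite_graph E" "\<And>v. degree E v \<le> k" "\<And>M. matching E M \<Longrightarrow> card M \<le> m"
  shows "card E \<le> chvatal_hanson_bound k m"
  using assms
proof (induction "card E" arbitrary: E m rule: less_induct)
  case less
  note E = less.prems(1)
  obtain M where M: "max_matching E M" using max_matching_exists[OF E] .
  have finE: "finite E" using E by (simp add: finite_graph_def)
  have "card E \<le> chvatal_hanson_bound k (card M)"
  proof (cases "\<exists>v\<in>\<Union>E. \<forall>N. max_matching E N \<longrightarrow> v \<in> \<Union>N")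
    case True
    then obtain v where v: "v \<in> \<Union>E" "\<And>N. max_matching E N \<Longrightarrow> v \<in> \<Union>N" by blast
    define F where "F = {e \<in> E. v \<notin> e}"
    have "F \<subset> E" using v(1) by (auto simp: F_def)
    have small: "card N < card M" if "matching F N" for N
    proof (rule ccontr)
      assume "\<not> card N < card M"
      moreover have "matching E N" using that \<open>F \<subset> E\<close> by (auto intro: matching_mono)
      ultimately have "max_matching E N" using M unfolding max_matching_def by (meson not_less order_trans)
      then have "v \<in> \<Union>N" by (rule v(2))
      then show False using that by (auto simp: matching_def F_def)
    qed
    obtain m' where m': "card M = Suc m'"
      using small[of "{}"] by (auto simp: matching_def gr0_conv_Suc)
    have "card F \<le> chvatal_hanson_bound k m'"
    proof (rule less.hyps)
      show "card F < card E" using \<open>F \<subset> E\<close> finE by (rule psubset_card_mono[rotated])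
      show "finite_graph F" using E \<open>F \<subset> E\<close> by (auto intro: finite_graph_subset)
      show "degree F w \<le> k" for w
        using less.prems(2)[of w] degree_mono[OF E, of F w] \<open>F \<subset> E\<close> by auto
      show "card N \<le> m'" if "matching F N" for N using small[OF that] m' by simp
    qed
    moreover have "E = F \<union> {e \<in> E. v \<in> e}" by (auto simp: F_def)
    then have "card E \<le> card F + degree E v" unfolding degree_def by (metis card_Un_le)
    ultimately have "card E \<le> chvatal_hanson_bound k m' + k" using less.prems(2)[of v] by linarith
    then show ?thesis using chvatal_hanson_bound_Suc[of k m'] m' by simp
  next
    case False
    define V where "V = \<Union>E"
    define r where "r = {(u, v). u \<in> V \<and> v \<in> V \<and>
      (u = v \<or> \<not> (\<exists>N. max_matching E N \<and> u \<notin> \<Union>N \<and> v \<notin> \<Union>N))}"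
    have missed: "\<exists>N. max_matching E N \<and> v \<notin> \<Union>N" if "v \<in> V" for v
      using False that by (auto simp: V_def)
    have equiv: "equiv V r"
    proof (rule equivI)
      show "r \<subseteq> V \<times> V" "refl_on V r" "sym r" by (auto simp: r_def refl_on_def sym_def)
      show "trans r"
      proof (rule transI)
        fix u t v assume ut: "(u, t) \<in> r" and tv: "(t, v) \<in> r"
        then obtain N0 where N0: "max_matching E N0" "t \<notin> \<Union>N0"
          using missed[of t] by (auto simp: r_def)
        show "(u, v) \<in> r"
        proof (rule ccontr)
          assume "(u, v) \<notin> r"
          then obtain L where L: "max_matching E L" "u \<notin> \<Union>L" "v \<notin> \<Union>L" "u \<noteq> v"
            using ut tv by (auto simp: r_def)
          then show False
            using gallai[OF E L N0] ut tv \<open>(u, v) \<notin> r\<close> unfolding r_def by blast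
        qed
      qed
    qed
    have finV: "finite V" using finite_vertices[OF E] by (simp add: V_def)
    let ?Q = "V // r"
    have finQ: "finite ?Q" using equiv finV by (metis equivE finite_quotient)
    define sub where "sub = (\<lambda>(X :: 'a set set) A. {e \<in> X. e \<subseteq> A})"
    \<comment> \<open>A maximum matching that missed both ends of an edge could be extended by it.\<close>
    have adj: "\<exists>A\<in>?Q. e \<subseteq> A" if "e \<in> E" for e
    proof -
      have "card e = 2" using E that by (simp add: finite_graph_def)
      then obtain a b where ab: "e = {a, b}" by (meson card_2_iff)
      have "(a, b) \<in> r"
        using edge_meets_max_matching[OF E _ that] that ab
        unfolding r_def V_def by auto
      then have "b \<in> r `` {a}" "a \<in> r `` {a}" using equiv by (auto simp: equiv_class_eq_iff)
      moreover have "r `` {a} \<in> ?Q" using ab that by (intro quotientI) (auto simp: V_def)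
      ultimately show ?thesis using ab by blast
    qed
    have disj: "sub X A \<inter> sub X B = {}" if "A \<in> ?Q" "B \<in> ?Q" "A \<noteq> B" "X \<subseteq> E" for A B X
    proof -
      have "A \<inter> B = {}" using quotient_disj[OF equiv that(1,2)] that(3) by blast
      moreover have "e \<noteq> {}" if "e \<in> E" for e using that E by (auto simp: finite_graph_def)
      ultimately show ?thesis using \<open>X \<subseteq> E\<close> unfolding sub_def by blast
    qed
    have split: "card X = (\<Sum>A\<in>?Q. card (sub X A))" if "X \<subseteq> E" for X
    proof -
      have "X = (\<Union>A\<in>?Q. sub X A)" using adj that unfolding sub_def by blast
      moreover have "finite (sub X A)" for A
        using finE that by (auto simp: sub_def intro: finite_subset)
      ultimately show ?thesis
        using card_UN_disjoint[OF finQ, of "sub X"] disj that by metis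
    qed
    have matM: "matching E M" using M by (simp add: max_matching_def)
    then have "M \<subseteq> E" by (simp add: matching_def)
    \<comment> \<open>Two vertices of one class that are both missed by the matching would not be equivalent.\<close>
    have size: "card A \<le> 2 * card (sub M A) + 1" if A: "A \<in> ?Q" for A
    proof -
      have "A \<subseteq> V" using A in_quotient_imp_subset[of V r A] equiv by (auto simp: equiv_def)
      then have finA: "finite A" using finV finite_subset by blast
      have "A \<inter> \<Union>M \<subseteq> \<Union>(sub M A)"
      proof
        fix x assume "x \<in> A \<inter> \<Union>M"
        then obtain e where e: "e \<in> M" "x \<in> e" "x \<in> A" by blast
        then obtain B where B: "B \<in> ?Q" "e \<subseteq> B" using adj \<open>M \<subseteq> E\<close> by blast
        then have "A = B" using quotient_disj[OF equiv A B(1)] e by blast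
        then show "x \<in> \<Union>(sub M A)" using e B by (auto simp: sub_def)
      qed
      moreover have "matching E (sub M A)"
        using matM by (auto simp: sub_def matching_def pairwise_def)
      ultimately have 1: "card (A \<inter> \<Union>M) \<le> 2 * card (sub M A)"
        using card_Union_matching[OF E] \<open>A \<subseteq> V\<close>
        by (metis (no_types, lifting) E card_mono finite_subset finite_vertices matching_def Union_mono)
      have "u = v" if "u \<in> A - \<Union>M" "v \<in> A - \<Union>M" for u v
      proof -
        have "(u, v) \<in> r" using quotient_eq_iff[OF equiv A A] that by blast
        then show ?thesis using that M by (auto simp: r_def)
      qed
      then have "card (A - \<Union>M) \<le> 1"
        using card_le_Suc0_iff_eq[of "A - \<Union>M"] finA by simp
      moreover have "card A = card (A \<inter> \<Union>M) + card (A - \<Union>M)"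
        using card_Int_Diff[OF finA] .
      ultimately show ?thesis using 1 by linarith
    qed
    have "card E = (\<Sum>A\<in>?Q. card (sub E A))" by (rule split) simp
    also have "\<dots> \<le> (\<Sum>A\<in>?Q. chvatal_hanson_bound k (card (sub M A)))"
    proof (rule sum_mono)
      fix A assume A: "A \<in> ?Q"
      have "finite A" using A finV in_quotient_imp_subset[of V r A] equiv
        by (auto simp: equiv_def intro: finite_subset)
      moreover have "sub E A \<subseteq> E" "\<Union>(sub E A) \<subseteq> A" by (auto simp: sub_def)
      moreover have "degree (sub E A) v \<le> k" for v
        using less.prems(2)[of v] degree_mono[OF E \<open>sub E A \<subseteq> E\<close>, of v] by linarith
      ultimately show "card (sub E A) \<le> chvatal_hanson_bound k (card (sub M A))"
        using size[OF A] E by (intro card_edges_small_vertex_set) (auto intro: finite_graph_subset)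
    qed
    also have "\<dots> \<le> chvatal_hanson_bound k (\<Sum>A\<in>?Q. card (sub M A))"
      by (rule chvatal_hanson_bound_sum)
    also have "(\<Sum>A\<in>?Q. card (sub M A)) = card M" using split[OF \<open>M \<subseteq> E\<close>] by simp
    finally show ?thesis .
  qed
  also have "card M \<le> m" using less.prems(3) M by (simp add: max_matching_def)
  then have "chvatal_hanson_bound k (card M) \<le> chvatal_hanson_bound k m"
    by (rule chvatal_hanson_bound_mono)
  finally show ?case .
qed

section \<open>Stars and matchings in links\<close>

definition link :: "'a set set \<Rightarrow> 'a \<Rightarrow> 'a set set" where
  "link D z = {p. z \<notin> p \<and> insert z p \<in> D}"

lemma link_mono: "D \<subseteq> D' \<Longrightarrow> link D z \<subseteq> link D' z"
  by (auto simp: link_def)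

lemma link_image: "link D z = (\<lambda>e. e - {z}) ` {e \<in> D. z \<in> e}"
  by (auto simp: link_def image_iff insert_absorb intro!: exI[of _ "insert z _"])

lemma finite_graph_link:
  assumes "finite D" "\<And>e. e \<in> D \<Longrightarrow> card e = 3"
  shows "finite_graph (link D z)"
proof -
  have "finite (link D z)" using assms by (simp add: link_image)
  moreover have "card (e - {z}) = 2" if "e \<in> D" "z \<in> e" for e
    using assms(2)[OF that(1)] that(2) by simp
  ultimately show ?thesis by (auto simp: finite_graph_def link_image)
qed

lemma card_link: "card (link D z) = card {e \<in> D. z \<in> e}"
  unfolding link_image by (intro card_image inj_onI) auto

text \<open>
  A star centred at \<open>c\<close> is the same thing as a matching in the link of \<open>c\<close>. This turns the forbidden
  subhypergraph into a bound on the matching number of every link.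
\<close>
lemma copy_star3_iff:
  assumes "uniform3 G" "s \<ge> 1"
  shows "contains_copy G (star3 s) \<longleftrightarrow> (\<exists>c P. matching (link (edges G) c) P \<and> card P = s)"
proof
  assume "contains_copy G (star3 s)"
  then obtain f where inj: "inj_on f {..2 * s}"
    and f: "\<And>i. i < s \<Longrightarrow> f ` {0, 2 * i + 1, 2 * i + 2} \<in> edges G"
    by (auto simp: contains_copy_def star3_def)
  have f_eq: "f i = f j \<longleftrightarrow> i = j" if "i \<le> 2 * s" "j \<le> 2 * s" for i j
    using inj that by (auto dest: inj_onD)
  define h where "h i = {f (2 * i + 1), f (2 * i + 2)}" for i
  have disj: "h i \<inter> h j = {}" if "i < s" "j < s" "i \<noteq> j" for i j
    using that by (auto simp: h_def f_eq; presburger)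
  have "inj_on h {..<s}"
    using disj by (auto simp: inj_on_def h_def)
  then have "card (h ` {..<s}) = s" by (simp add: card_image)
  moreover have "h i \<in> link (edges G) (f 0)" if "i < s" for i
    using f[OF that] that by (auto simp: link_def h_def f_eq)
  then have "matching (link (edges G) (f 0)) (h ` {..<s})"
    using disj by (auto simp: matching_def pairwise_def disjnt_def)
  ultimately show "\<exists>c P. matching (link (edges G) c) P \<and> card P = s" by blast
next
  assume "\<exists>c P. matching (link (edges G) c) P \<and> card P = s"
  then obtain c P where P: "matching (link (edges G) c) P" "card P = s" by blast
  have fin: "finite P" using P(2) assms(2) by (simp add: card_ge_0_finite)
  obtain h where h: "bij_betw h {..<s} P"
    using ex_bij_betw_nat_finite[OF fin] P(2) by (auto simp: atLeast0LessThan)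
  have hP: "h i \<in> link (edges G) c" if "i < s" for i
    using h that P(1) by (auto simp: bij_betw_def matching_def)
  have "\<exists>a b. h i = {a, b} \<and> a \<noteq> b" if "i < s" for i
  proof -
    have "card (insert c (h i)) = 3" "c \<notin> h i"
      using hP[OF that] assms(1) by (auto simp: link_def uniform3_def)
    moreover from this have "finite (h i)" by (metis card.infinite finite_insert zero_neq_numeral)
    ultimately have "card (h i) = 2" by simp
    then show ?thesis by (auto simp: card_2_iff)
  qed
  then obtain a b where ab: "\<And>i. i < s \<Longrightarrow> h i = {a i, b i} \<and> a i \<noteq> b i" by metis
  have disj: "h i \<inter> h j = {}" if "i < s" "j < s" "i \<noteq> j" for i j
  proof -
    have "h i \<noteq> h j" "h i \<in> P" "h j \<in> P"
      using h that by (auto simp: bij_betw_def inj_on_def)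
    then show ?thesis using matching_unique[OF P(1), of "h i" "h j"] by blast
  qed
  define f where "f v = (if v = 0 then c else if odd v then a (v div 2) else b ((v - 1) div 2))" for v :: nat
  have f_simps: "f 0 = c" "f (2 * i + 1) = a i" "f (2 * i + 2) = b i" for i
    by (auto simp: f_def)
  have vs: "{..2 * s} = insert 0 ((\<lambda>i. 2 * i + 1) ` {..<s} \<union> (\<lambda>i. 2 * i + 2) ` {..<s})" (is "_ = ?R")
  proof
    show "{..2 * s} \<subseteq> ?R"
    proof
      fix v assume v: "v \<in> {..2 * s}"
      consider "v = 0" | "odd v" | "even v" "v > 0" by blast
      then show "v \<in> ?R"
      proof cases
        case 2
        then obtain i where "v = 2 * i + 1" by (auto elim: oddE)
        then show ?thesis using v by auto
      next
        case 3
        then obtain i where "v = 2 * i" "i > 0" by (auto elim: evenE)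
        then have "v = 2 * (i - 1) + 2" "i - 1 < s" using v by auto
        then show ?thesis by blast
      qed simp
    qed
  qed auto
  have cn: "c \<noteq> a i" "c \<noteq> b i" if "i < s" for i
    using hP[OF that] ab[OF that] by (auto simp: link_def)
  have ne: "a i = a j \<longleftrightarrow> i = j" "b i = b j \<longleftrightarrow> i = j" if "i < s" "j < s" for i j
    using disj[OF that] ab[OF that(1)] ab[OF that(2)] by (cases "i = j"; auto)+
  have ne': "a i \<noteq> b j" if "i < s" "j < s" for i j
    using disj[OF that] ab that by (cases "i = j") auto
  have "inj_on f {..2 * s}"
    unfolding vs inj_on_def
    by (auto simp: f_simps f_simps[simplified] cn ne ne' cn[symmetric] ne'[symmetric])
  moreover have img: "f ` {0, 2 * i + 1, 2 * i + 2} \<in> edges G" if "i < s" for i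
  proof -
    have "f ` {0, 2 * i + 1, 2 * i + 2} = insert c (h i)" using ab[OF that] f_simps(1) f_simps(2)[of i] f_simps(3)[of i] by auto
    then show ?thesis using hP[OF that] by (simp add: link_def)
  qed
  moreover have "f ` {..2 * s} \<subseteq> verts G"
  proof -
    have "0 \<in> {..<s}" using assms(2) by simp
    then have "{..<s} \<noteq> {}" by blast
    have "f ` {..2 * s} = (\<Union>i<s. f ` {0, 2 * i + 1, 2 * i + 2})"
      unfolding vs using \<open>{..<s} \<noteq> {}\<close> by auto
    also have "\<dots> \<subseteq> verts G"
    proof (rule UN_least)
      fix i assume "i \<in> {..<s}"
      then have "f ` {0, 2 * i + 1, 2 * i + 2} \<in> edges G" by (intro img) simp
      then show "f ` {0, 2 * i + 1, 2 * i + 2} \<subseteq> verts G"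
        using assms(1) by (simp only: uniform3_def)
    qed
    finally show ?thesis .
  qed
  ultimately show "contains_copy G (star3 s)"
    by (auto simp: contains_copy_def star3_def)
qed

text \<open>
  The greedy choice suffices here, since each set alone is at least as large as the number of sets.
\<close>
lemma distinct_representatives:
  assumes "finite I" "\<And>i. i \<in> I \<Longrightarrow> finite (N i) \<and> card I \<le> card (N i)"
  shows "\<exists>z. inj_on z I \<and> (\<forall>i\<in>I. z i \<in> N i)"
  using assms
proof (induction I)
  case (insert i I)
  then obtain z where z: "inj_on z I" "\<forall>j\<in>I. z j \<in> N j" by fastforce
  have "card (z ` I) < card (N i)"
    using insert.hyps insert.prems[of i] card_image_le[of I z] by simp
  then obtain w where w: "w \<in> N i" "w \<notin> z ` I"
    using insert.hyps by (metis card_mono finite_imageI not_le subsetI)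
  have "inj_on (z(i := w)) (insert i I)"
    using z w insert.hyps by (auto simp: inj_on_def)
  moreover have "\<forall>j\<in>insert i I. (z(i := w)) j \<in> N j" using z w by auto
  ultimately show ?case by blast
qed simp

lemma codeg_eq_card_link:
  assumes "uniform3 G" "card p = 2"
  shows "codeg G p = card {z \<in> verts G. p \<in> link (edges G) z}"
proof -
  have fin: "finite p" using assms(2) by (metis card.infinite zero_neq_numeral)
  have "{e \<in> edges G. p \<subseteq> e} = (\<lambda>z. insert z p) ` {z \<in> verts G. p \<in> link (edges G) z}" (is "?L = ?R")
  proof
    show "?L \<subseteq> ?R"
    proof
      fix e assume e: "e \<in> ?L"
      then have c: "card e = 3" "e \<subseteq> verts G" using assms(1) by (auto simp: uniform3_def)
      have "card (e - p) = 1" using e c(1) assms(2) fin by (simp add: card_Diff_subset)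
      then obtain z where "e - p = {z}" by (auto simp: card_1_singleton_iff)
      then have z: "e = insert z p" "z \<notin> p" using e by auto
      then show "e \<in> ?R" using e c by (auto simp: link_def)
    qed
  qed (auto simp: link_def)
  moreover have "inj_on (\<lambda>z. insert z p) {z \<in> verts G. p \<in> link (edges G) z}"
    by (auto simp: inj_on_def link_def)
  ultimately show ?thesis by (simp add: codeg_def card_image)
qed

lemma sum_codeg_eq_sum_link:
  assumes "uniform3 G" "finite P" "\<And>p. p \<in> P \<Longrightarrow> card p = 2"
  shows "(\<Sum>p\<in>P. codeg G p) = (\<Sum>z\<in>verts G. card (link (edges G) z \<inter> P))"
proof -
  have "(\<Sum>p\<in>P. codeg G p) = (\<Sum>p\<in>P. card {z \<in> verts G. p \<in> link (edges G) z})"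
    using assms by (intro sum.cong) (auto intro: codeg_eq_card_link)
  also have "\<dots> = (\<Sum>z\<in>verts G. card {p \<in> P. p \<in> link (edges G) z})"
    using assms by (intro sum_multicount_gen) (auto simp: uniform3_def)
  also have "\<dots> = (\<Sum>z\<in>verts G. card (link (edges G) z \<inter> P))"
    by (intro sum.cong refl arg_cong[of _ _ card]) auto
  finally show ?thesis .
qed

lemma finite_edges: "uniform3 G \<Longrightarrow> finite (edges G)"
  by (rule finite_subset[of _ "Pow (verts G)"]) (auto simp: uniform3_def)

lemma sum_card_link:
  assumes "uniform3 G" "D \<subseteq> edges G"
  shows "(\<Sum>z\<in>verts G. card (link D z)) = 3 * card D"
proof -
  have "finite D" using assms finite_edges finite_subset by blast
  moreover have "\<forall>e\<in>D. card {z \<in> verts G. z \<in> e} = 3"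
  proof
    fix e assume "e \<in> D"
    then have "e \<subseteq> verts G" "card e = 3" using assms by (auto simp: uniform3_def)
    moreover from this have "{z \<in> verts G. z \<in> e} = e" by blast
    ultimately show "card {z \<in> verts G. z \<in> e} = 3" by simp
  qed
  ultimately show ?thesis
    using assms unfolding card_link by (subst sum_multicount) (auto simp: uniform3_def)
qed

lemma sum_codeg_eq_edges:
  assumes "uniform3 G"
  shows "(\<Sum>p | p \<subseteq> verts G \<and> card p = 2. codeg G p) = 3 * card (edges G)"
proof -
  let ?P = "{p. p \<subseteq> verts G \<and> card p = 2}"
  have "\<forall>e\<in>edges G. card {p \<in> ?P. p \<subseteq> e} = 3"
  proof
    fix e assume "e \<in> edges G"
    then have e: "e \<subseteq> verts G" "card e = 3" using assms by (auto simp: uniform3_def)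
    then have "finite e" using assms finite_subset by (auto simp: uniform3_def)
    have "{p \<in> ?P. p \<subseteq> e} = {p. p \<subseteq> e \<and> card p = 2}" using e by auto
    then show "card {p \<in> ?P. p \<subseteq> e} = 3"
      using n_subsets[OF \<open>finite e\<close>, of 2] e by (simp add: choose_two)
  qed
  then show ?thesis
    unfolding codeg_def using assms finite_edges[OF assms]
    by (subst sum_multicount) (auto simp: uniform3_def)
qed

section \<open>The upper bound\<close>

text \<open>
  The threshold \<open>2 * s\<close> leaves enough third vertices for the greedy construction of a star out of
  \<open>s\<close> heavy pairs through a common vertex, and it is still independent of the number of vertices.
\<close>
definition heavy :: "'a hypergraph \<Rightarrow> nat \<Rightarrow> 'a set set" where
  "heavy G s = {p. p \<subseteq> verts G \<and> card p = 2 \<and> 2 * s \<le> codeg G p}"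

text \<open>
  Suppose that \<open>s\<close> heavy pairs \<open>{x, y}\<close> with \<open>y \<in> Y\<close> meet at \<open>x\<close>. Each of them has at least \<open>2 * s\<close> third
  vertices, of which at most \<open>s\<close> lie in \<open>Y\<close>; so distinct third vertices outside \<open>Y\<close> can be chosen,
  which produces a star centred at \<open>x\<close>.
\<close>
lemma degree_heavy:
  assumes G: "uniform3 G" and free: "\<not> contains_copy G (star3 s)" and s: "s \<ge> 1"
  shows "degree (heavy G s) x \<le> s - 1"
proof (rule ccontr)
  let ?Y = "{y. y \<noteq> x \<and> {x, y} \<in> heavy G s}"
  assume "\<not> ?thesis"
  then have large: "s \<le> degree (heavy G s) x" by simp
  have inj: "inj_on (\<lambda>y. {x, y}) ?Y" by (auto simp: inj_on_def doubleton_eq_iff)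
  have "{p \<in> heavy G s. x \<in> p} = (\<lambda>y. {x, y}) ` ?Y" (is "?L = ?R")
  proof
    show "?L \<subseteq> ?R"
    proof
      fix p assume p: "p \<in> ?L"
      then have "card p = 2" "x \<in> p" by (auto simp: heavy_def)
      then have "\<exists>y. p = {x, y} \<and> y \<noteq> x"
        by (metis card_2_iff insertE insert_commute singletonD)
      then show "p \<in> ?R" using p by auto
    qed
  qed auto
  then have "degree (heavy G s) x = card ?Y"
    unfolding degree_def by (simp add: card_image[OF inj])
  then have "s \<le> card ?Y" using large by simp
  then obtain Y where Y: "Y \<subseteq> ?Y" "card Y = s" by (rule obtain_subset_with_card_n)
  have finY: "finite Y" using Y(2) s by (simp add: card_ge_0_finite)
  define N where "N y = {z \<in> verts G. {x, y} \<in> link (edges G) z} - Y" for y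
  have "\<exists>z. inj_on z Y \<and> (\<forall>y\<in>Y. z y \<in> N y)"
  proof (rule distinct_representatives[OF finY])
    fix y assume y: "y \<in> Y"
    have fV: "finite {z \<in> verts G. {x, y} \<in> link (edges G) z}"
      using G by (simp add: uniform3_def)
    have "2 * s \<le> codeg G {x, y}" "card {x, y} = 2" using y Y(1) by (auto simp: heavy_def)
    then have "2 * s \<le> card {z \<in> verts G. {x, y} \<in> link (edges G) z}"
      using codeg_eq_card_link[OF G, of "{x, y}"] by simp
    then show "finite (N y) \<and> card Y \<le> card (N y)"
      unfolding N_def using fV diff_card_le_card_Diff[OF finY, of "{z \<in> verts G. {x, y} \<in> link (edges G) z}"] Y(2)
      by simp
  qed
  then obtain z where z: "inj_on z Y" "\<And>y. y \<in> Y \<Longrightarrow> z y \<in> N y" by blast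
  define h where "h y = {y, z y}" for y
  have zl: "z y \<notin> Y" "z y \<noteq> x" "z y \<noteq> y" "{x, y, z y} \<in> edges G" if "y \<in> Y" for y
    using z(2)[OF that] by (auto simp: N_def link_def insert_commute)
  have disj: "h y \<inter> h y' = {}" if "y \<in> Y" "y' \<in> Y" "y \<noteq> y'" for y y'
    using zl that z(1) by (auto simp: h_def dest: inj_onD)
  have "inj_on h Y" using disj by (auto simp: inj_on_def h_def)
  then have "card (h ` Y) = s" using Y(2) by (simp add: card_image)
  moreover have "h y \<in> link (edges G) x" if "y \<in> Y" for y
    using zl[OF that] that Y(1) by (auto simp: link_def h_def)
  then have "matching (link (edges G) x) (h ` Y)"
    using disj by (auto simp: matching_def pairwise_def disjnt_def)
  ultimately show False using free copy_star3_iff[OF G s] by blast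
qed

lemma matching_link_le:
  assumes G: "uniform3 G" and free: "\<not> contains_copy G (star3 s)" and s: "s \<ge> 1"
    and M: "matching (link (edges G) z) M"
  shows "card M \<le> s - 1"
proof (rule ccontr)
  assume "\<not> ?thesis"
  then have "s \<le> card M" by simp
  then obtain P where "P \<subseteq> M" "card P = s" by (rule obtain_subset_with_card_n)
  then have "matching (link (edges G) z) P"
    using M by (auto simp: matching_def intro: pairwise_subset)
  then show False using free copy_star3_iff[OF G s] \<open>card P = s\<close> by blast
qed

text \<open>
  The sum is counted over the third vertex \<open>z\<close>. The heavy pairs in the link of \<open>z\<close> form a graph with
  maximum degree and matching number at most \<open>s - 1\<close>, so \<open>chvatal_hanson\<close> applies with the very
  constant of the main term.
\<close>
lemma sum_heavy_codeg_le:
  assumes G: "uniform3 G" and free: "\<not> contains_copy G (star3 s)" and s: "s \<ge> 1"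
  shows "(\<Sum>p\<in>heavy G s. codeg G p) \<le> chvatal_hanson_bound (s - 1) (s - 1) * card (verts G)"
proof -
  have fg: "finite_graph (heavy G s)"
    using G finite_subset[of "heavy G s" "Pow (verts G)"]
    by (auto simp: finite_graph_def heavy_def uniform3_def)
  have "card (link (edges G) z \<inter> heavy G s) \<le> chvatal_hanson_bound (s - 1) (s - 1)" for z
  proof (rule chvatal_hanson)
    show "finite_graph (link (edges G) z \<inter> heavy G s)" using fg by (rule finite_graph_subset) simp
    show "degree (link (edges G) z \<inter> heavy G s) v \<le> s - 1" for v
      using degree_heavy[OF G free s, of v] degree_mono[OF fg, of "link (edges G) z \<inter> heavy G s" v] by simp
    show "card M \<le> s - 1" if "matching (link (edges G) z \<inter> heavy G s) M" for M
      using matching_link_le[OF G free s matching_mono[OF that Int_lower1]] .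
  qed
  then have "(\<Sum>z\<in>verts G. card (link (edges G) z \<inter> heavy G s))
      \<le> (\<Sum>z\<in>verts G. chvatal_hanson_bound (s - 1) (s - 1))"
    by (intro sum_mono)
  then show ?thesis
    using sum_codeg_eq_sum_link[OF G, of "heavy G s"] fg
    by (auto simp: finite_graph_def mult.commute)
qed

text \<open>
  In the hypergraph of those triples that contain no heavy pair, degrees in links are codegrees of
  light pairs, hence bounded; the matching numbers of the links are bounded as well. So each link has
  boundedly many edges. It is this linear bound that makes the light pairs negligible.
\<close>
lemma card_light_edges_le:
  assumes G: "uniform3 G" and free: "\<not> contains_copy G (star3 s)" and s: "s \<ge> 1"
  shows "card {e \<in> edges G. \<forall>p\<in>heavy G s. \<not> p \<subseteq> e}
    \<le> chvatal_hanson_bound (2 * s) (s - 1) * card (verts G)"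
proof -
  define D where "D = {e \<in> edges G. \<forall>p\<in>heavy G s. \<not> p \<subseteq> e}"
  have DG: "D \<subseteq> edges G" by (auto simp: D_def)
  have "card (link D z) \<le> chvatal_hanson_bound (2 * s) (s - 1)" for z
  proof (rule chvatal_hanson)
    show fg: "finite_graph (link D z)"
      using G DG finite_edges[OF G] by (intro finite_graph_link) (auto simp: uniform3_def intro: finite_subset)
    show "card M \<le> s - 1" if "matching (link D z) M" for M
      using matching_link_le[OF G free s matching_mono[OF that link_mono[OF DG]]] .
    show "degree (link D z) v \<le> 2 * s" for v
    proof (cases "\<exists>p\<in>link D z. v \<in> p")
      case True
      then obtain p where p: "z \<notin> p" "insert z p \<in> D" "v \<in> p" by (auto simp: link_def)
      then have "insert z p \<subseteq> verts G" using DG G unfolding uniform3_def by blast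
      moreover have "z \<noteq> v" using p by blast
      ultimately have zv: "{z, v} \<subseteq> verts G" "card {z, v} = 2" "{z, v} \<subseteq> insert z p"
        using p by auto
      have "{z, v} \<notin> heavy G s" using p zv by (auto simp: D_def)
      then have "codeg G {z, v} \<le> 2 * s" using zv by (simp add: heavy_def)
      moreover have "card {p \<in> link D z. v \<in> p} \<le> card {e \<in> edges G. {z, v} \<subseteq> e}"
      proof (rule card_inj_on_le)
        show "inj_on (insert z) {p \<in> link D z. v \<in> p}" by (auto simp: inj_on_def link_def)
        show "insert z ` {p \<in> link D z. v \<in> p} \<subseteq> {e \<in> edges G. {z, v} \<subseteq> e}"
          using DG by (auto simp: link_def)
      qed (use finite_edges[OF G] in simp)
      ultimately show ?thesis by (simp add: degree_def codeg_def)
    next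
      case False
      then have none: "{p \<in> link D z. v \<in> p} = {}" by blast
      show ?thesis unfolding degree_def none by simp
    qed
  qed
  then have "(\<Sum>z\<in>verts G. card (link D z)) \<le> (\<Sum>z\<in>verts G. chvatal_hanson_bound (2 * s) (s - 1))"
    by (intro sum_mono)
  then show ?thesis using sum_card_link[OF G DG] by (simp add: D_def mult.commute)
qed

lemma card_edges_le:
  assumes G: "uniform3 G" and free: "\<not> contains_copy G (star3 s)" and s: "s \<ge> 1"
  shows "card (edges G) \<le> (chvatal_hanson_bound (s - 1) (s - 1) + chvatal_hanson_bound (2 * s) (s - 1)) * card (verts G)"
proof -
  define D where "D = {e \<in> edges G. \<forall>p\<in>heavy G s. \<not> p \<subseteq> e}"
  have finH: "finite (heavy G s)"
    using G finite_subset[of "heavy G s" "Pow (verts G)"] by (auto simp: heavy_def uniform3_def)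
  have "edges G = D \<union> (\<Union>p\<in>heavy G s. {e \<in> edges G. p \<subseteq> e})" by (auto simp: D_def)
  then have "card (edges G) \<le> card D + card (\<Union>p\<in>heavy G s. {e \<in> edges G. p \<subseteq> e})"
    by (metis card_Un_le)
  also have "card (\<Union>p\<in>heavy G s. {e \<in> edges G. p \<subseteq> e}) \<le> (\<Sum>p\<in>heavy G s. codeg G p)"
    unfolding codeg_def by (rule card_UN_le[OF finH])
  finally show ?thesis
    using sum_heavy_codeg_le[OF assms] card_light_edges_le[OF assms]
    by (simp add: D_def algebra_simps)
qed

text \<open>
  A heavy pair has codegree at most \<open>n\<close>, so the squares over heavy pairs are at most \<open>n\<close> times the
  sum of \<open>sum_heavy_codeg_le\<close>, which gives the quadratic term. A light pair has codegree below
  \<open>2 * s\<close>, so the squares over light pairs are controlled by the number of edges, which is linear.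
\<close>
lemma co2_le:
  assumes G: "uniform3 G" and free: "\<not> contains_copy G (star3 s)" and s: "s \<ge> 1"
  shows "co2 G \<le> chvatal_hanson_bound (s - 1) (s - 1) * (card (verts G))\<^sup>2
    + 6 * s * (chvatal_hanson_bound (s - 1) (s - 1) + chvatal_hanson_bound (2 * s) (s - 1)) * card (verts G)"
proof -
  let ?n = "card (verts G)" and ?H = "heavy G s"
  let ?P = "{p. p \<subseteq> verts G \<and> card p = 2}"
  have finP: "finite ?P" using G by (simp add: uniform3_def)
  have HP: "?H \<subseteq> ?P" by (auto simp: heavy_def)
  have "(\<Sum>p\<in>?H. (codeg G p)\<^sup>2) \<le> (\<Sum>p\<in>?H. ?n * codeg G p)"
  proof (rule sum_mono)
    fix p assume "p \<in> ?H"
    then have "codeg G p \<le> ?n"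
      using G HP by (subst codeg_eq_card_link[OF G]) (auto simp: uniform3_def intro: card_mono)
    then show "(codeg G p)\<^sup>2 \<le> ?n * codeg G p" by (simp add: power2_eq_square)
  qed
  also have "\<dots> = ?n * (\<Sum>p\<in>?H. codeg G p)" by (simp add: sum_distrib_left)
  also have "\<dots> \<le> ?n * (chvatal_hanson_bound (s - 1) (s - 1) * ?n)"
    using sum_heavy_codeg_le[OF assms] by (rule mult_left_mono) simp
  finally have H: "(\<Sum>p\<in>?H. (codeg G p)\<^sup>2) \<le> chvatal_hanson_bound (s - 1) (s - 1) * ?n\<^sup>2"
    by (simp add: power2_eq_square algebra_simps)
  have "(\<Sum>p\<in>?P - ?H. (codeg G p)\<^sup>2) \<le> (\<Sum>p\<in>?P - ?H. 2 * s * codeg G p)"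
  proof (rule sum_mono)
    fix p assume "p \<in> ?P - ?H"
    then have "codeg G p \<le> 2 * s" by (auto simp: heavy_def)
    then show "(codeg G p)\<^sup>2 \<le> 2 * s * codeg G p" by (simp add: power2_eq_square)
  qed
  also have "\<dots> \<le> (\<Sum>p\<in>?P. 2 * s * codeg G p)" using finP by (intro sum_mono2) auto
  also have "\<dots> = 6 * s * card (edges G)"
    using sum_codeg_eq_edges[OF G] by (simp flip: sum_distrib_left)
  also have "\<dots> \<le> 6 * s * ((chvatal_hanson_bound (s - 1) (s - 1) + chvatal_hanson_bound (2 * s) (s - 1)) * ?n)"
    using card_edges_le[OF assms] by (rule mult_left_mono) simp
  finally have L: "(\<Sum>p\<in>?P - ?H. (codeg G p)\<^sup>2)
    \<le> 6 * s * (chvatal_hanson_bound (s - 1) (s - 1) + chvatal_hanson_bound (2 * s) (s - 1)) * ?n"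
    by (simp only: mult.assoc)
  have "co2 G = (\<Sum>p\<in>?P - ?H. (codeg G p)\<^sup>2) + (\<Sum>p\<in>?H. (codeg G p)\<^sup>2)"
    unfolding co2_def using sum.subset_diff[OF HP finP] .
  then show ?thesis using H L by linarith
qed

section \<open>Constructions for the lower bound\<close>

text \<open>
  All triples that extend an edge of the graph \<open>H\<close> on \<open>{..<w}\<close> by a vertex outside \<open>{..<w}\<close>. Each edge of
  \<open>H\<close> gets codegree \<open>n - w\<close>, close to the largest possible value.
\<close>
definition cone :: "nat \<Rightarrow> nat set set \<Rightarrow> nat \<Rightarrow> nat hypergraph" where
  "cone w H n = \<lparr>verts = {..<n}, edges = {insert z p | z p. p \<in> H \<and> z \<in> {w..<n}}\<rparr>"

lemma uniform3_cone:
  assumes "finite_graph H" "\<Union>H \<subseteq> {..<w}" "w \<le> n"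
  shows "uniform3 (cone w H n)"
proof -
  have "card (insert z p) = 3 \<and> insert z p \<subseteq> {..<n}" if "p \<in> H" "z \<in> {w..<n}" for z p
  proof -
    have "p \<subseteq> {..<w}" using assms(2) that by blast
    moreover from this have "z \<notin> p" "finite p" using that finite_subset by auto
    ultimately show ?thesis using assms that by (auto simp: finite_graph_def)
  qed
  then show ?thesis by (auto simp: uniform3_def cone_def)
qed

text \<open>
  A star with centre outside \<open>{..<w}\<close> is a matching in \<open>H\<close>. For a centre \<open>c\<close> inside, the edges of a star
  restrict to distinct edges of \<open>H\<close> at \<open>c\<close>. So the bounds on the matching number and on the
  degrees exclude the two kinds of stars.
\<close>
lemma cone_no_star:
  assumes H: "finite_graph H" "\<Union>H \<subseteq> {..<w}" and n: "w \<le> n" and s: "s \<ge> 1"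
    and deg: "\<And>v. degree H v < s" and mat: "\<And>M. matching H M \<Longrightarrow> card M < s"
  shows "\<not> contains_copy (cone w H n) (star3 s)"
proof
  assume "contains_copy (cone w H n) (star3 s)"
  then obtain c P where P: "matching (link (edges (cone w H n)) c) P" "card P = s"
    using copy_star3_iff[OF uniform3_cone[OF H n] s] by blast
  have edge: "\<exists>z q. insert c p = insert z q \<and> q \<in> H \<and> w \<le> z \<and> c \<notin> p \<and> q \<subseteq> {..<w}"
    if "p \<in> P" for p
  proof -
    have "c \<notin> p" "insert c p \<in> edges (cone w H n)"
      using that P(1) by (auto simp: matching_def link_def)
    moreover from this(2) obtain z q where "insert c p = insert z q" "q \<in> H" "z \<in> {w..<n}"
      unfolding cone_def by auto
    moreover from this(2) have "q \<subseteq> {..<w}" using H(2) by blast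
    ultimately show ?thesis by auto
  qed
  show False
  proof (cases "c < w")
    case True
    define h where "h p = insert c (p \<inter> {..<w})" for p
    have h: "h p \<in> H \<and> p \<inter> {..<w} \<noteq> {}" if p: "p \<in> P" for p
    proof -
      obtain z q where zq: "insert c p = insert z q" "q \<in> H" "w \<le> z" "c \<notin> p" "q \<subseteq> {..<w}"
        using edge[OF p] by blast
      have "insert c p \<inter> {..<w} = q" using zq by auto
      then have "h p = q" using True by (auto simp: h_def)
      moreover have "q \<noteq> {c}" using zq(2) H(1) by (auto simp: finite_graph_def)
      ultimately show ?thesis using zq(2) by (auto simp: h_def)
    qed
    have "inj_on h P"
    proof (rule inj_onI)
      fix p q assume pq: "p \<in> P" "q \<in> P" "h p = h q"
      obtain y where y: "y \<in> p" "y < w" using h[OF pq(1)] by blast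
      moreover have "y \<noteq> c" using edge[OF pq(1)] y by blast
      ultimately have "y \<in> q" using pq(3) by (auto simp: h_def)
      then show "p = q" using matching_unique[OF P(1) pq(1,2) y(1)] by simp
    qed
    then have "s = card (h ` P)" using P(2) by (simp add: card_image)
    also have "\<dots> \<le> degree H c"
      unfolding degree_def using h H(1) by (intro card_mono) (auto simp: finite_graph_def h_def)
    finally show False using deg[of c] by simp
  next
    case False
    have "P \<subseteq> H"
    proof
      fix p assume p: "p \<in> P"
      obtain z q where zq: "insert c p = insert z q" "q \<in> H" "w \<le> z" "c \<notin> p" "q \<subseteq> {..<w}"
        using edge[OF p] by blast
      then have "c = z" "z \<notin> q" using False by auto
      then have "p = q" using zq(1,4) by (simp add: insert_ident)
      then show "p \<in> H" using zq(2) by simp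
    qed
    then have "matching H P" using P(1) by (simp add: matching_def)
    then show False using mat P(2) by blast
  qed
qed

lemma co2_cone_ge:
  assumes H: "finite_graph H" "\<Union>H \<subseteq> {..<w}" and n: "w \<le> n"
  shows "card H * (n - w)\<^sup>2 \<le> co2 (cone w H n)"
proof -
  let ?G = "cone w H n"
  have "n - w \<le> codeg ?G p" if p: "p \<in> H" for p
  proof -
    have "p \<subseteq> {..<w}" using p H by blast
    have cone: "insert z p \<in> edges ?G \<and> p \<subseteq> insert z p" if "z \<in> {w..<n}" for z
      using p that by (auto simp: cone_def intro!: exI[of _ z] exI[of _ p])
    from \<open>p \<subseteq> {..<w}\<close> have "inj_on (\<lambda>z. insert z p) {w..<n}"
      by (auto simp: inj_on_def)
    then have "n - w = card ((\<lambda>z. insert z p) ` {w..<n})" by (simp add: card_image)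
    also have "\<dots> \<le> codeg ?G p"
      unfolding codeg_def using finite_edges[OF uniform3_cone[OF assms]]
      by (intro card_mono image_subsetI) (simp_all add: cone)
    finally show ?thesis .
  qed
  then have "(\<Sum>p\<in>H. (n - w)\<^sup>2) \<le> (\<Sum>p\<in>H. (codeg ?G p)\<^sup>2)"
    by (intro sum_mono power_mono) auto
  also have "\<dots> \<le> co2 ?G"
    unfolding co2_def
  proof (rule sum_mono2)
    show "finite {p. p \<subseteq> verts ?G \<and> card p = 2}" by (simp add: cone_def)
    show "H \<subseteq> {p. p \<subseteq> verts ?G \<and> card p = 2}"
      using H n by (fastforce simp: cone_def finite_graph_def)
  qed simp
  finally show ?thesis by simp
qed

definition complete_graph :: "'a set \<Rightarrow> 'a set set" where
  "complete_graph A = {e. e \<subseteq> A \<and> card e = 2}"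

lemma card_complete_graph: "finite A \<Longrightarrow> card (complete_graph A) = card A * (card A - 1) div 2"
  by (simp add: complete_graph_def n_subsets choose_two)

lemma complete_graph_disjoint:
  assumes "A \<inter> B = {}"
  shows "complete_graph A \<inter> complete_graph B = {}"
proof -
  have "card e \<noteq> 2" if "e \<subseteq> A" "e \<subseteq> B" for e
    using assms that by (metis Int_greatest card.empty subset_empty zero_neq_numeral)
  then show ?thesis by (auto simp: complete_graph_def)
qed

lemma finite_graph_complete: "finite A \<Longrightarrow> finite_graph (complete_graph A)"
  by (simp add: finite_graph_def complete_graph_def)

lemma degree_le_card_neighbours:
  assumes "finite_graph E" "finite N" "\<And>w. {v, w} \<in> E \<Longrightarrow> v \<noteq> w \<Longrightarrow> w \<in> N"
  shows "degree E v \<le> card N"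
proof -
  have "{e \<in> E. v \<in> e} \<subseteq> (\<lambda>w. {v, w}) ` N"
  proof
    fix e assume e: "e \<in> {e \<in> E. v \<in> e}"
    then have "card e = 2" "v \<in> e" using assms(1) by (auto simp: finite_graph_def)
    then have "\<exists>w. e = {v, w} \<and> v \<noteq> w" by (metis card_2_iff insertE insert_commute singletonD)
    then show "e \<in> (\<lambda>w. {v, w}) ` N" using e assms(3) by blast
  qed
  then show ?thesis
    unfolding degree_def using assms(2) by (meson surj_card_le)
qed

text \<open>
  Two disjoint complete graphs on \<open>s\<close> vertices. Since \<open>s\<close> is odd, each of them contains at most
  \<open>(s - 1) div 2\<close> disjoint edges.
\<close>
lemma extremal_graph_odd:
  fixes s :: nat
  assumes "odd s" "s \<ge> 3"
  obtains H :: "nat set set" where "finite_graph H" "\<Union>H \<subseteq> {..<2 * s}" "\<And>v. degree H v < s"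
    "\<And>M. matching H M \<Longrightarrow> card M < s" "card H = s * (s - 1)"
proof -
  let ?A = "{..<s}" and ?B = "{s..<2 * s}"
  define H where "H = complete_graph ?A \<union> complete_graph ?B"
  have fg: "finite_graph H"
    using finite_graph_complete[of ?A] finite_graph_complete[of ?B]
    unfolding H_def finite_graph_def by blast
  have sub: "\<Union>H \<subseteq> {..<2 * s}" by (auto simp: H_def complete_graph_def subset_iff)
  have AB: "complete_graph ?A \<inter> complete_graph ?B = {}"
    by (rule complete_graph_disjoint) auto
  have "card (complete_graph ?A) = s * (s - 1) div 2" "card (complete_graph ?B) = s * (s - 1) div 2"
    by (simp_all add: card_complete_graph)
  moreover have "card H = card (complete_graph ?A) + card (complete_graph ?B)"
    unfolding H_def using finite_graph_complete[of ?A] finite_graph_complete[of ?B] AB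
    by (intro card_Un_disjoint) (simp_all add: finite_graph_def)
  moreover have "even (s * (s - 1))" using assms(1) by simp
  ultimately have "card H = s * (s - 1)" by presburger
  moreover have "degree H v < s" for v
  proof -
    let ?N = "if v < s then ?A - {v} else ?B - {v}"
    have "degree H v \<le> card ?N" if "v < 2 * s"
      using fg by (rule degree_le_card_neighbours) (auto simp: H_def complete_graph_def)
    moreover have "card ?N < s" if "v < 2 * s" using that assms(2) by auto
    moreover have "degree H v = 0" if "\<not> v < 2 * s"
    proof -
      have none: "{e \<in> H. v \<in> e} = {}" using sub that by auto
      show ?thesis unfolding degree_def none by simp
    qed
    ultimately show ?thesis using assms(2) by fastforce
  qed
  moreover have "card M < s" if M: "matching H M" for M
  proof -
    define MA where "MA = M \<inter> complete_graph ?A"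
    define MB where "MB = M \<inter> complete_graph ?B"
    have "card (\<Union>MA) \<le> card ?A" by (intro card_mono) (auto simp: MA_def complete_graph_def)
    moreover have "card (\<Union>MB) \<le> card ?B" by (intro card_mono) (auto simp: MB_def complete_graph_def)
    moreover have "matching H MA" "matching H MB"
      using M by (auto simp: MA_def MB_def matching_def pairwise_def)
    ultimately have "2 * card MA \<le> s" "2 * card MB \<le> s"
      using card_Union_matching[OF fg] by auto
    then have "card MA + card MB < s" using assms(1) by presburger
    moreover have "M = MA \<union> MB" using M by (auto simp: MA_def MB_def matching_def H_def)
    then have "card M \<le> card MA + card MB" by (metis card_Un_le)
    ultimately show ?thesis by linarith
  qed
  ultimately show ?thesis using that fg sub by blast
qed

text \<open>
  On \<open>2 * s - 1\<close> vertices every matching has fewer than \<open>s\<close> edges, so only the degrees matter. The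
  disjoint union of complete graphs on \<open>s\<close> and \<open>s - 1\<close> vertices leaves one unit of degree unused at
  each vertex of the smaller part. Removing the matching \<open>R\<close> from the larger part and joining its
  \<open>s - 2\<close> ends to distinct vertices of the smaller part by \<open>X\<close> keeps the degrees below \<open>s\<close>
  and gains \<open>(s - 2) div 2\<close> edges.
\<close>
lemma extremal_graph_even:
  fixes s :: nat
  assumes "even s" "s \<ge> 3"
  obtains H :: "nat set set" where "finite_graph H" "\<Union>H \<subseteq> {..<2 * s - 1}" "\<And>v. degree H v < s"
    "\<And>M. matching H M \<Longrightarrow> card M < s" "card H = (s - 1)\<^sup>2 + (s - 2) div 2"
proof -
  obtain i where "s = 2 * i" using assms(1) by (rule evenE)
  then obtain j where j: "s = 2 * j + 2" "j \<ge> 1" using assms(2) by (intro that[of "i - 1"]) auto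
  let ?A = "{..<s}" and ?B = "{s..<2 * s - 1}"
  \<comment> \<open>With \<open>s = 2 * j + 2\<close> the matching \<open>R\<close> has \<open>j\<close> edges and leaves only \<open>s - 2\<close> and \<open>s - 1\<close> uncovered.\<close>
  define R where "R = (\<lambda>i::nat. {2 * i, 2 * i + 1}) ` {..<j}"
  define X where "X = (\<lambda>i. {i, s + i}) ` {..<2 * j}"
  define H where "H = (complete_graph ?A - R) \<union> complete_graph ?B \<union> X"
  have fin: "finite (complete_graph ?A)" "finite (complete_graph ?B)"
    using finite_graph_complete by (auto simp: finite_graph_def)
  have fg: "finite_graph H"
    using fin by (auto simp: H_def X_def finite_graph_def complete_graph_def j)
  have sub: "\<Union>H \<subseteq> {..<2 * s - 1}" by (auto simp: H_def X_def complete_graph_def subset_iff j)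
  have R: "R \<subseteq> complete_graph ?A" "card R = j"
  proof -
    show "R \<subseteq> complete_graph ?A" by (auto simp: R_def complete_graph_def j)
    have "inj_on (\<lambda>i::nat. {2 * i, 2 * i + 1}) {..<j}" by (auto simp: inj_on_def doubleton_eq_iff)
    then show "card R = j" by (simp add: R_def card_image)
  qed
  have X: "card X = 2 * j"
  proof -
    have "inj_on (\<lambda>i. {i, s + i}) {..<2 * j}" by (auto simp: inj_on_def doubleton_eq_iff)
    then show ?thesis by (simp add: X_def card_image)
  qed
  have AB: "complete_graph ?A \<inter> complete_graph ?B = {}"
    by (rule complete_graph_disjoint) auto
  have ABX: "(complete_graph ?A \<union> complete_graph ?B) \<inter> X = {}"
    by (auto simp: complete_graph_def X_def j)
  have "card H = card (complete_graph ?A - R) + card (complete_graph ?B) + card X"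
    unfolding H_def using fin AB ABX X
    by (subst card_Un_disjoint; (subst card_Un_disjoint)?) (auto simp: X_def)
  also have "card (complete_graph ?A - R) = card (complete_graph ?A) - j"
    using R fin by (simp add: card_Diff_subset finite_subset)
  also have "card (complete_graph ?A) = (j + 1) * (2 * j + 1)"
    by (simp add: card_complete_graph j)
  also have "card (complete_graph ?B) = (2 * j + 1) * j"
    by (simp add: card_complete_graph j)
  finally have "card H = (s - 1)\<^sup>2 + (s - 2) div 2"
    using X by (simp add: j power2_eq_square algebra_simps)
  moreover have "degree H v < s" for v
  proof -
    define mate where "mate = (if even v then v + 1 else v - 1)"
    define N where "N = (if v < 2 * j then insert (s + v) (?A - {v, mate})
      else if v < s then ?A - {v} else if v < 2 * s - 1 then insert (v - s) (?B - {v}) else {})"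
    have "degree H v \<le> card N"
      using fg
    proof (rule degree_le_card_neighbours)
      show "finite N" by (simp add: N_def)
      fix w assume w: "{v, w} \<in> H" "v \<noteq> w"
      consider "{v, w} \<in> complete_graph ?A" "{v, w} \<notin> R" | "{v, w} \<in> complete_graph ?B" | "{v, w} \<in> X"
        using w by (auto simp: H_def)
      then show "w \<in> N"
      proof cases
        case 1
        have "w \<noteq> mate" if "v < 2 * j"
        proof
          assume "w = mate"
          moreover have "v div 2 < j" using that by simp
          ultimately have "{v, w} = {2 * (v div 2), 2 * (v div 2) + 1}"
            by (auto simp: mate_def elim!: evenE oddE)
          then show False using 1(2) \<open>v div 2 < j\<close> by (auto simp: R_def)
        qed
        then show ?thesis using 1(1) w(2) by (auto simp: N_def complete_graph_def)
      next
        case 2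
        then show ?thesis using w(2) by (auto simp: N_def complete_graph_def j)
      next
        case 3
        then show ?thesis by (auto simp: N_def X_def doubleton_eq_iff j)
      qed
    qed
    also have "card N < s"
    proof -
      consider "v < 2 * j" | "2 * j \<le> v" "v < s" | "s \<le> v" "v < 2 * s - 1" | "2 * s - 1 \<le> v" by linarith
      then show ?thesis
      proof cases
        case 1
        then have "mate < s" "mate \<noteq> v" "v < s" by (auto simp: mate_def j elim!: oddE)
        then show ?thesis using 1 by (auto simp: N_def card_insert_if card_Diff_subset j)
      next
        case 4
        then show ?thesis by (simp add: N_def j)
      qed (auto simp: N_def card_insert_if j)
    qed
    finally show ?thesis .
  qed
  moreover have "card M < s" if M: "matching H M" for M
  proof -
    have "card (\<Union>M) \<le> card {..<2 * s - 1}"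
      using M sub by (intro card_mono) (auto simp: matching_def)
    then show ?thesis using card_Union_matching[OF fg M] assms(2) by simp
  qed
  ultimately show ?thesis using that fg sub by blast
qed

section \<open>The asymptotic value\<close>

text \<open>
  The hypothesis on \<open>card H\<close> says that \<open>H\<close> is an extremal graph for \<open>chvatal_hanson\<close>. Then the lower
  bound from the cone over \<open>H\<close> and the upper bound of \<open>co2_le\<close> have the same leading coefficient.
\<close>
lemma exco2_star3_asymp:
  fixes H :: "nat set set"
  assumes s: "s \<ge> 3" and H: "finite_graph H" "\<Union>H \<subseteq> {..<w}" "\<And>v. degree H v < s"
    "\<And>M. matching H M \<Longrightarrow> card M < s"
    and c: "card H = chvatal_hanson_bound (s - 1) (s - 1)"
  shows "(\<lambda>n. real (exco2 n (star3 s))) \<sim>[at_top] (\<lambda>n. real (card H) * (real n)\<^sup>2)"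
proof -
  define C where "C = 6 * s * (card H + chvatal_hanson_bound (2 * s) (s - 1))"
  let ?S = "\<lambda>n. {co2 G | G :: nat hypergraph. uniform3 G \<and> verts G = {..<n} \<and> \<not> contains_copy G (star3 s)}"
  have upper: "exco2 n (star3 s) \<le> card H * n\<^sup>2 + C * n" for n
  proof -
    have "edges (star3 s) \<noteq> {}" using card_edges_star3[of s] s by auto
    then have "exco2 n (star3 s) \<in> ?S n"
      unfolding exco2_def by (intro Max_in finite_exco2_set exco2_set_nonempty)
    then obtain G :: "nat hypergraph" where "exco2 n (star3 s) = co2 G" "uniform3 G"
      "verts G = {..<n}" "\<not> contains_copy G (star3 s)" by blast
    then show ?thesis using co2_le[of G s] s by (simp add: c C_def)
  qed
  have lower: "card H * (n - w)\<^sup>2 \<le> exco2 n (star3 s)" if "w \<le> n" for n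
  proof -
    have "co2 (cone w H n) \<in> ?S n"
      using uniform3_cone[OF H(1,2) that] cone_no_star[OF H(1,2) that _ H(3,4)] s
      by (auto simp: cone_def)
    then have "co2 (cone w H n) \<le> exco2 n (star3 s)"
      unfolding exco2_def by (intro Max_ge finite_exco2_set)
    then show ?thesis using co2_cone_ge[OF H(1,2) that] by linarith
  qed
  have "0 < (s - 1) * (s - 1)" using s by simp
  then have pos: "real (card H) > 0" unfolding c chvatal_hanson_bound_def by linarith
  let ?F = "real (card H)"
  show ?thesis
  proof (rule asymp_equivI'_const[where c = 1, simplified])
    show "(\<lambda>n. real (exco2 n (star3 s)) / (?F * (real n)\<^sup>2)) \<longlonglongrightarrow> 1"
    proof (rule tendsto_sandwich)
      show "\<forall>\<^sub>F n in at_top. (1 - real w / real n)\<^sup>2 \<le> real (exco2 n (star3 s)) / (?F * (real n)\<^sup>2)"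
        using eventually_ge_at_top[of "max w 1"]
      proof eventually_elim
        case (elim n)
        have "real (card H * (n - w)\<^sup>2) \<le> real (exco2 n (star3 s))"
          using lower elim by (simp only: of_nat_le_iff max.bounded_iff)
        then have "?F * (real n - real w)\<^sup>2 \<le> real (exco2 n (star3 s))"
          using elim by (simp add: of_nat_diff)
        moreover have "(1 - real w / real n)\<^sup>2 = ?F * (real n - real w)\<^sup>2 / (?F * (real n)\<^sup>2)"
          using elim pos by (simp add: field_simps power2_eq_square)
        ultimately show ?case by (simp only:) (intro divide_right_mono, auto)
      qed
      show "\<forall>\<^sub>F n in at_top. real (exco2 n (star3 s)) / (?F * (real n)\<^sup>2) \<le> 1 + real C / ?F / real n"
        using eventually_ge_at_top[of 1]
      proof eventually_elim
        case (elim n)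
        have "real (exco2 n (star3 s)) \<le> real (card H * n\<^sup>2 + C * n)"
          using upper by (simp only: of_nat_le_iff)
        then have "real (exco2 n (star3 s)) \<le> ?F * (real n)\<^sup>2 + real C * real n" by simp
        moreover have "1 + real C / ?F / real n = (?F * (real n)\<^sup>2 + real C * real n) / (?F * (real n)\<^sup>2)"
          using elim pos by (simp add: field_simps power2_eq_square)
        ultimately show ?case by (simp only:) (intro divide_right_mono, auto)
      qed
      have "(\<lambda>n. (1 - real w / real n)\<^sup>2) \<longlonglongrightarrow> (1 - 0)\<^sup>2"
        by (intro tendsto_intros lim_const_over_n)
      then show "(\<lambda>n. (1 - real w / real n)\<^sup>2) \<longlonglongrightarrow> 1" by simp
      have "(\<lambda>n. 1 + real C / ?F / real n) \<longlonglongrightarrow> 1 + 0"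
        by (intro tendsto_intros lim_const_over_n)
      then show "(\<lambda>n. 1 + real C / ?F / real n) \<longlonglongrightarrow> 1" by simp
    qed
  qed
qed

lemma chvatal_hanson_bound_diagonal:
  assumes "s \<ge> 3"
  shows "odd s \<Longrightarrow> chvatal_hanson_bound (s - 1) (s - 1) = s * (s - 1)"
    and "even s \<Longrightarrow> chvatal_hanson_bound (s - 1) (s - 1) = (s - 1)\<^sup>2 + (s - 2) div 2"
proof -
  assume "odd s"
  then obtain j where j: "s = 2 * j + 1" by (auto elim: oddE)
  then have "j \<ge> 1" using assms by simp
  then show "chvatal_hanson_bound (s - 1) (s - 1) = s * (s - 1)"
    by (simp add: chvatal_hanson_bound_def j algebra_simps)
next
  assume "even s"
  then obtain i where "s = 2 * i" by (auto elim: evenE)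
  then obtain j where j: "s = 2 * j + 2" "j \<ge> 1" using assms by (intro that[of "i - 1"]) auto
  have "(2 * j + 1) div (j + 1) = 1" using j(2) by (intro div_nat_eqI) auto
  then show "chvatal_hanson_bound (s - 1) (s - 1) = (s - 1)\<^sup>2 + (s - 2) div 2"
    by (simp add: chvatal_hanson_bound_def j power2_eq_square)
qed

theorem theorem1p6:
  fixes s :: nat
  assumes "s \<ge> 3"
  shows "(odd s \<longrightarrow>
            (\<lambda>n. real (exco2 n (star3 s))) \<sim>[at_top]
            (\<lambda>n. real s * (real s - 1) * (real n)\<^sup>2)) \<and>
         (even s \<longrightarrow>
            (\<lambda>n. real (exco2 n (star3 s))) \<sim>[at_top]
            (\<lambda>n. ((real s)\<^sup>2 - 3 / 2 * real s) * (real n)\<^sup>2))"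
proof (intro conjI impI)
  assume "odd s"
  then obtain H :: "nat set set" where H: "finite_graph H" "\<Union>H \<subseteq> {..<2 * s}" "\<And>v. degree H v < s"
    "\<And>M. matching H M \<Longrightarrow> card M < s" "card H = s * (s - 1)"
    using extremal_graph_odd assms by blast
  have "real (card H) = real s * (real s - 1)" using H(5) assms by (simp add: of_nat_diff)
  then show "(\<lambda>n. real (exco2 n (star3 s))) \<sim>[at_top] (\<lambda>n. real s * (real s - 1) * (real n)\<^sup>2)"
    using exco2_star3_asymp[OF assms H(1-4)] H(5) chvatal_hanson_bound_diagonal(1)[OF assms \<open>odd s\<close>]
    by (simp only:)
next
  assume "even s"
  then obtain H :: "nat set set" where H: "finite_graph H" "\<Union>H \<subseteq> {..<2 * s - 1}" "\<And>v. degree H v < s"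
    "\<And>M. matching H M \<Longrightarrow> card M < s" "card H = (s - 1)\<^sup>2 + (s - 2) div 2"
    using extremal_graph_even assms by blast
  have "2 * ((s - 2) div 2) + 2 = s" using \<open>even s\<close> assms by simp
  then have "2 * real ((s - 2) div 2) + 2 = real s"
    by (metis of_nat_add of_nat_mult of_nat_numeral)
  then have "real ((s - 2) div 2) = (real s - 2) / 2" by simp
  moreover have "real ((s - 1)\<^sup>2) = (real s - 1)\<^sup>2" using assms by (simp add: of_nat_diff)
  ultimately have "real (card H) = (real s - 1)\<^sup>2 + (real s - 2) / 2"
    unfolding H(5) of_nat_add by (simp only:)
  then have "real (card H) = (real s)\<^sup>2 - 3 / 2 * real s"
    by (simp add: power2_eq_square field_simps)
  then show "(\<lambda>n. real (exco2 n (star3 s))) \<sim>[at_top] (\<lambda>n. ((real s)\<^sup>2 - 3 / 2 * real s) * (real n)\<^sup>2)"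
    using exco2_star3_asymp[OF assms H(1-4)] H(5) chvatal_hanson_bound_diagonal(2)[OF assms \<open>even s\<close>]
    by (simp only:)
qed

end
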